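(* Let $1\le m<n$, let $\lambda_1<\dots<\lambda_n$ be real numbers in an open interval $(a,b)$, and let $w_1,\dots,w_n\in\mathbb{C}\setminus\{0\}$. Let $s\in\mathbb{R}$ be distinct from $\lambda_1,\dots,\lambda_n$, and let $\theta_1<\dots<\theta_m$ in $(a,b)$, all distinct from $s$, and $c_1,\dots,c_m\in\mathbb{C}$ satisfy $$\sum_{j=1}^n |w_j|^2\, r(\lambda_j)=\sum_{j=1}^m |c_j|^2\, r(\theta_j)\qquad\text{for all } r(\lambda)=\frac{p(\lambda)}{(\lambda-s)^{2m-2}},\ p\in\Pi_{2m-2}.$$ Assume in addition that $s\in(\theta_1,\theta_m)$. Then: (a) for $k=1,\dots,m-1$, $$\mu_n([\theta_1,\theta_k])\le|c_1|^2+\dots+|c_k|^2\le\mu_n\big((a,\theta_{k+1})\cup(\theta_m,b)\big);$$ (b) for indices $1<j<k<m$, $$\mu_n([\theta_j,\theta_k])\le|c_j|^2+\dots+|c_k|^2\le\mu_n\big((\theta_{j-1},\theta_{k+1})\big);$$ (c) for $j=2,\dots,m$, $$\mu_n([\theta_j,\theta_m])\le|c_j|^2+\dots+|c_m|^2\le\mu_n\big((a,\theta_1)\cup(\theta_{j-1},b)\big).$$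
   Context: $\Pi_j$ denotes the complex polynomials of degree $\le j$. For a set $R\subset(a,b)$, $\mu_n(R)=\sum_{j:\ \lambda_j\in R}|w_j|^2$. *)

theory Defs
  imports
    "HOL-Analysis.Interval_Integral"
    "HOL-Computational_Algebra.Polynomial"
begin

text \<open>The sequences \<open>\<lambda>\<close> and \<open>w\<close> are indexed by \<open>{1..n}\<close>; their values
  outside this range are irrelevant.\<close>

definition spectral_mass ::
    "nat \<Rightarrow> (nat \<Rightarrow> real) \<Rightarrow> (nat \<Rightarrow> complex) \<Rightarrow> real set \<Rightarrow> real" where
  "spectral_mass n lam w R = (\<Sum>j | j \<in> {1..n} \<and> lam j \<in> R. (cmod (w j))\<^sup>2)"

definition rational_with_pole :: "complex poly \<Rightarrow> real \<Rightarrow> nat \<Rightarrow> real \<Rightarrow> complex" where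
  "rational_with_pole p s d x = poly p (of_real x) / of_real (x - s) ^ d"

end

theory Submission
  imports Defs
begin

text \<open>
  The substitution \<open>x = 1 / (\<lambda> - s)\<close> turns the hypothesis into a quadrature formula with \<open>m\<close> nodes
  that is exact for real polynomials of degree at most \<open>2m - 2\<close>. The Chebyshev--Markov--Stieltjes
  argument, testing it on a polynomial that majorises the indicator of a half-line ending at a node
  and agrees with it at all nodes, compares the masses of half-lines. Let \<open>e(R)\<close> be the mass of
  the nodes in \<open>R\<close> minus \<open>\<mu>\<^sub>n(R)\<close>. Back in the variable \<open>\<lambda>\<close>, and on both sides of the pole alike,
  these comparisons say \<open>e((-\<infinity>, \<theta>\<^sub>k)) \<le> e((-\<infinity>, s)) \<le> e((-\<infinity>, \<theta>\<^sub>k])\<close> for every \<open>k\<close>.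
  All the claims follow by subtracting two of these, as \<open>e\<close> is additive with total \<open>0\<close>.
\<close>

section \<open>Newton interpolation on a cone of rational functions\<close>

text \<open>This cone is closed under divided differences at points to the left of \<open>R\<close>, which makes every
  coefficient and remainder of Newton interpolation nonnegative there.\<close>
inductive fraction_cone :: "real set \<Rightarrow> (real \<Rightarrow> real) \<Rightarrow> bool" for R where
  const: "0 \<le> c \<Longrightarrow> fraction_cone R (\<lambda>x. c)"
| add: "fraction_cone R f \<Longrightarrow> fraction_cone R g \<Longrightarrow> fraction_cone R (\<lambda>x. f x + g x)"
| divide: "fraction_cone R f \<Longrightarrow> r \<in> R \<Longrightarrow> fraction_cone R (\<lambda>x. f x / (r - x))"

lemma fraction_cone_nonneg:
  assumes "fraction_cone R f" "\<And>r. r \<in> R \<Longrightarrow> x < r"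
  shows "0 \<le> f x"
  using assms(1)
proof induction
  case (divide f r)
  then show ?case using assms(2)[of r] by simp
qed auto

text \<open>The divided difference of \<open>f x / (r - x)\<close> at \<open>l\<close> is
  \<open>(f' x + f l / (r - l)) / (r - x)\<close>. It stays in the cone because \<open>f l\<close>
  is nonnegative and \<open>l < r\<close>.\<close>

lemma fraction_cone_divided_difference:
  assumes "fraction_cone R f" "\<And>r. r \<in> R \<Longrightarrow> l < r"
  shows "\<exists>f'. fraction_cone R f' \<and> (\<forall>x. x \<notin> R \<longrightarrow> f x = f l + (x - l) * f' x)"
  using assms(1)
proof induction
  case (const c)
  show ?case by (intro exI[of _ "\<lambda>x. 0"]) (auto intro: fraction_cone.const)
next
  case (add f g)
  then obtain f' g' where
    "fraction_cone R f'" "\<forall>x. x \<notin> R \<longrightarrow> f x = f l + (x - l) * f' x"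
    "fraction_cone R g'" "\<forall>x. x \<notin> R \<longrightarrow> g x = g l + (x - l) * g' x"
    by blast
  then show ?case
    by (intro exI[of _ "\<lambda>x. f' x + g' x"]) (auto intro: fraction_cone.add simp: algebra_simps)
next
  case (divide f r)
  then obtain f' where f': "fraction_cone R f'" "\<And>x. x \<notin> R \<Longrightarrow> f x = f l + (x - l) * f' x"
    by blast
  have "l < r" using divide assms(2) by blast
  have fl: "0 \<le> f l / (r - l)"
    using fraction_cone_nonneg[OF divide(1)] assms(2) \<open>l < r\<close> by simp
  have "fraction_cone R (\<lambda>x. (f' x + f l / (r - l)) / (r - x))"
    by (intro fraction_cone.divide[OF fraction_cone.add] f' fraction_cone.const fl divide)
  moreover have "f x / (r - x) = f l / (r - l) + (x - l) * ((f' x + f l / (r - l)) / (r - x))"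
    if "x \<notin> R" for x
  proof -
    have "r - x \<noteq> 0" "r - l \<noteq> 0" using that divide(2) \<open>l < r\<close> by auto
    then show ?thesis unfolding f'(2)[OF that] by (simp add: divide_simps) (simp add: algebra_simps)
  qed
  ultimately show ?case by blast
qed

lemma fraction_cone_prod:
  assumes "finite R"
  shows "fraction_cone R (\<lambda>x. 1 / (\<Prod>r\<in>R. (r - x)\<^sup>2))"
proof -
  \<comment> \<open>Inducting over subsets \<open>S\<close> keeps the parameter \<open>R\<close> of
    the cone fixed.\<close>
  have "fraction_cone R (\<lambda>x. 1 / (\<Prod>r\<in>S. (r - x)\<^sup>2))" if "finite S" "S \<subseteq> R" for S
    using that
  proof induction
    case empty
    then show ?case by (simp add: fraction_cone.const)
  next
    case (insert r S)
    then have "fraction_cone R (\<lambda>x. 1 / (\<Prod>r\<in>S. (r - x)\<^sup>2) / (r - x) / (r - x))"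
      by (intro fraction_cone.divide) auto
    then show ?case using insert by (simp add: power2_eq_square mult_ac)
  qed
  then show ?thesis using assms by blast
qed

text \<open>Newton's scheme takes one divided difference per list entry, so a repeated entry is a
  multiple node. The Newton coefficients are values of cone functions to the left of
  \<open>R\<close>, and every factor \<open>x - l\<close> is nonnegative for
  \<open>x \<ge> z\<close>; hence \<open>g\<close> is nonnegative there. The alternative
  \<open>g = 0\<close> covers the empty list.\<close>

lemma fraction_cone_interpolation:
  fixes z :: real
  assumes "\<And>r. r \<in> R \<Longrightarrow> z < r"
    and "fraction_cone R h" "\<forall>l\<in>set ls. l \<le> z"
  shows "\<exists>g k. (g = 0 \<or> degree g < length ls) \<and> fraction_cone R k \<and> (\<forall>x\<ge>z. 0 \<le> poly g x) \<and>
           (\<forall>x. x \<notin> R \<longrightarrow> h x = poly g x + k x * (\<Prod>l\<leftarrow>ls. x - l))"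
  using assms(2,3)
proof (induction ls arbitrary: h)
  case Nil
  then show ?case by (intro exI[of _ 0] exI[of _ h]) auto
next
  case (Cons l ls)
  have lR: "l < r" if "r \<in> R" for r using Cons.prems assms(1)[OF that] by auto
  obtain h' where h': "fraction_cone R h'" "\<And>x. x \<notin> R \<Longrightarrow> h x = h l + (x - l) * h' x"
    using fraction_cone_divided_difference[OF Cons.prems(1) lR] by blast
  obtain g k where gk: "g = 0 \<or> degree g < length ls" "fraction_cone R k"
      "\<And>x. x \<ge> z \<Longrightarrow> 0 \<le> poly g x"
      "\<And>x. x \<notin> R \<Longrightarrow> h' x = poly g x + k x * (\<Prod>l\<leftarrow>ls. x - l)"
    using Cons.IH[OF h'(1)] Cons.prems(2) by auto
  have "0 \<le> h l" by (rule fraction_cone_nonneg[OF Cons.prems(1) lR])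
  define G where "G = [:h l:] + [:-l, 1:] * g"
  have "degree G < length (l # ls)"
  proof (cases "g = 0")
    case False
    have "degree ([:-l, 1:] * g) = 1 + degree g"
      using False by (subst degree_mult_eq) auto
    then show ?thesis using gk(1) False unfolding G_def
      by (intro le_less_trans[OF degree_add_le[of _ "1 + degree g"]]) auto
  qed (simp add: G_def)
  moreover have "0 \<le> poly G x" if "x \<ge> z" for x
    using \<open>0 \<le> h l\<close> gk(3)[OF that] Cons.prems(2) that by (auto simp: G_def left_diff_distrib[symmetric])
  moreover have "h x = poly G x + k x * (\<Prod>l\<leftarrow>l # ls. x - l)" if "x \<notin> R" for x
    unfolding h'(2)[OF that] gk(4)[OF that] G_def by (simp add: algebra_simps)
  ultimately show ?case using gk(2) by blast
qed

section \<open>Polynomial majorant of a half-line\<close>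

text \<open>With \<open>L\<close>, \<open>R\<close> the points of \<open>Y\<close> left and right of \<open>z\<close>, the majorant is \<open>\<Prod>\<^sub>r(x - r)\<^sup>2 g(x)\<close>, where
  \<open>g\<close> interpolates \<open>1 / \<Prod>\<^sub>r(x - r)\<^sup>2\<close> simply at \<open>z\<close> and doubly at \<open>L\<close>.\<close>
lemma half_line_majorant:
  fixes z :: real
  assumes "finite Y" "z \<in> Y"
  obtains p where "degree p \<le> 2 * card Y - 2"
    "\<And>y. y \<in> Y \<Longrightarrow> poly p y = (if y \<le> z then 1 else 0)"
    "\<And>x. x \<le> z \<Longrightarrow> 1 \<le> poly p x" "\<And>x. 0 \<le> poly p x"
proof -
  define L R where "L = {y \<in> Y. y < z}" and "R = {y \<in> Y. z < y}"
  have fin: "finite L" "finite R" using assms(1) by (auto simp: L_def R_def)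
  have "Y = insert z (L \<union> R)" using assms(2) by (auto simp: L_def R_def)
  moreover have "z \<notin> L \<union> R" "L \<inter> R = {}" by (auto simp: L_def R_def)
  ultimately have card: "card Y = Suc (card L + card R)"
    using fin by (simp add: card_Un_disjoint)
  define ls where "ls = sorted_list_of_set L"
  define h where "h = (\<lambda>x. 1 / (\<Prod>r\<in>R. (r - x)\<^sup>2))"
  have len: "length ls = card L" and setls: "set ls = L" and dist: "distinct ls"
    using fin by (auto simp: ls_def)
  have "fraction_cone R h" unfolding h_def by (rule fraction_cone_prod[OF fin(2)])
  moreover have zR: "z < r" if "r \<in> R" for r using that by (simp add: R_def)
  moreover have "\<forall>l\<in>set (z # ls @ ls). l \<le> z" unfolding setls set_append by (auto simp: setls L_def)
  ultimately obtain g k where gk: "g = 0 \<or> degree g < length (z # ls @ ls)" "fraction_cone R k"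
      "\<And>x. x \<ge> z \<Longrightarrow> 0 \<le> poly g x"
      "\<And>x. x \<notin> R \<Longrightarrow> h x = poly g x + k x * (\<Prod>l\<leftarrow>z # ls @ ls. x - l)"
    using fraction_cone_interpolation[of R z h "z # ls @ ls"] by blast
  have "(\<Prod>l\<leftarrow>ls. x - l) = (\<Prod>l\<in>L. x - l)" for x
    using prod.distinct_set_conv_list[OF dist, of "\<lambda>l. x - l"] setls by simp
  then have rep: "h x = poly g x + k x * ((x - z) * (\<Prod>l\<in>L. x - l)\<^sup>2)" if "x \<notin> R" for x
    using gk(4)[OF that] by (simp add: power2_eq_square)
  define q where "q = (\<Prod>r\<in>R. [:- r, 1:]\<^sup>2)"
  have q: "poly q x = (\<Prod>r\<in>R. (r - x)\<^sup>2)" for x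
    by (simp add: q_def poly_prod poly_power power2_commute)
  have qpos: "0 < poly q x" if "x \<notin> R" for x
    unfolding q using that by (intro prod_pos) auto
  have hq: "poly q x * h x = 1" if "x \<notin> R" for x
    using qpos[OF that] by (simp add: h_def q)
  have below: "x \<notin> R" if "x \<le> z" for x using that zR by fastforce
  \<comment> \<open>Apart from the simple factor \<open>x - z\<close>, the remainder consists of a
    square and a nonnegative \<open>k x\<close>, so to the left of \<open>z\<close> it is at most
    0.\<close>
  have hg: "h x \<le> poly g x" if "x \<le> z" for x
  proof -
    have "0 \<le> k x" using gk(2) by (rule fraction_cone_nonneg) (use that zR in fastforce)
    then have "k x * ((x - z) * (\<Prod>l\<in>L. x - l)\<^sup>2) \<le> 0"
      using that by (intro mult_nonneg_nonpos mult_nonpos_nonneg) auto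
    then show ?thesis using rep[OF below[OF that]] by linarith
  qed
  show thesis
  proof
    have "degree q \<le> 2 * card R"
    proof -
      have "degree q \<le> (\<Sum>r\<in>R. degree ([:- r, 1:]\<^sup>2))"
        unfolding q_def using degree_prod_sum_le[OF fin(2)] by (simp add: o_def)
      also have "\<dots> = 2 * card R" by (simp add: degree_power_eq)
      finally show ?thesis .
    qed
    \<comment> \<open>There are \<open>2 * card L + 1\<close> nodes counted with multiplicity;
      together with \<open>q\<close> the degree is at most \<open>2 * (card L + card R)\<close>, and
      \<open>card Y\<close> exceeds that bracket by one.\<close>
    moreover have "degree g \<le> 2 * card L" using gk(1) len by auto
    ultimately show "degree (q * g) \<le> 2 * card Y - 2"
      using degree_mult_le[of q g] card by simp
  next
    fix y assume y: "y \<in> Y"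
    show "poly (q * g) y = (if y \<le> z then 1 else 0)"
    proof (cases "y \<le> z")
      case True
      then have "y = z \<or> y \<in> L" using y by (auto simp: L_def)
      then have "(y - z) * (\<Prod>l\<in>L. y - l)\<^sup>2 = 0" using fin by auto
      then have "h y = poly g y" using rep[OF below[OF True]] by (metis add.right_neutral mult_zero_right)
      then show ?thesis using True hq[OF below[OF True]] by simp
    next
      case False
      then have "y \<in> R" using y by (auto simp: R_def)
      then show ?thesis using False fin by (auto simp: q)
    qed
  next
    fix x assume "x \<le> z"
    then show "1 \<le> poly (q * g) x"
      using hq[OF below, of x] hg[of x] qpos[OF below, of x]
        mult_left_mono[of "h x" "poly g x" "poly q x"] by simp
  next
    fix x
    \<comment> \<open>To the left of \<open>z\<close> this comes from \<open>h \<le> g\<close>, to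
      the right from the nonnegative Newton form.\<close>
    have "0 \<le> poly g x"
    proof (cases "x \<le> z")
      case True
      have "0 \<le> h x" by (simp add: h_def prod_nonneg)
      then show ?thesis using hg[OF True] by linarith
    qed (use gk(3) in simp)
    moreover have "0 \<le> poly q x" unfolding q by (simp add: prod_nonneg)
    ultimately show "0 \<le> poly (q * g) x" by simp
  qed
qed

section \<open>Chebyshev-Markov-Stieltjes inequalities\<close>

text \<open>The majorant \<open>p\<close> equals the indicator at the nodes \<open>y j\<close>, so
  its quadrature sum is exactly the node mass. At the points \<open>x i\<close> it only dominates
  the indicator, and the weights \<open>W i\<close> are nonnegative.\<close>

lemma stieltjes_le:
  fixes x :: "'i \<Rightarrow> real" and y :: "'j \<Rightarrow> real"
  assumes "finite I" "finite J" "inj_on y J" "\<And>i. i \<in> I \<Longrightarrow> 0 \<le> W i"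
    and quad: "\<And>q. degree q \<le> 2 * card J - 2 \<Longrightarrow>
      (\<Sum>i\<in>I. W i * poly q (x i)) = (\<Sum>j\<in>J. C j * poly q (y j))"
    and "k \<in> J"
  shows "(\<Sum>i | i \<in> I \<and> x i \<le> y k. W i) \<le> (\<Sum>j | j \<in> J \<and> y j \<le> y k. C j)"
proof -
  have "card (y ` J) = card J" by (rule card_image[OF assms(3)])
  then obtain p where p: "degree p \<le> 2 * card J - 2"
    "\<And>t. t \<in> y ` J \<Longrightarrow> poly p t = (if t \<le> y k then 1 else 0)"
    "\<And>x. x \<le> y k \<Longrightarrow> 1 \<le> poly p x" "\<And>x. 0 \<le> poly p x"
    using half_line_majorant[of "y ` J" "y k"] assms(2,6) by (metis finite_imageI imageI)
  have "(\<Sum>i | i \<in> I \<and> x i \<le> y k. W i) = (\<Sum>i\<in>I. if x i \<le> y k then W i else 0)"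
    using assms(1) by (simp add: sum.inter_filter)
  also have "\<dots> \<le> (\<Sum>i\<in>I. W i * poly p (x i))"
    by (intro sum_mono) (use assms(4) p(3,4) mult_left_mono[OF p(3)] in \<open>fastforce\<close>)
  also have "\<dots> = (\<Sum>j\<in>J. C j * poly p (y j))" by (rule quad[OF p(1)])
  also have "\<dots> = (\<Sum>j\<in>J. if y j \<le> y k then C j else 0)"
    by (intro sum.cong) (auto simp: p(2))
  also have "\<dots> = (\<Sum>j | j \<in> J \<and> y j \<le> y k. C j)"
    using assms(2) by (simp add: sum.inter_filter)
  finally show ?thesis .
qed

text \<open>Reflection \<open>x \<mapsto> -x\<close> turns the previous bound into one for right
  half-lines; complements reverse it, since both total masses agree (test polynomial 1).\<close>

lemma stieltjes_less:
  fixes x :: "'i \<Rightarrow> real" and y :: "'j \<Rightarrow> real"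
  assumes "finite I" "finite J" "inj_on y J" "\<And>i. i \<in> I \<Longrightarrow> 0 \<le> W i"
    and quad: "\<And>q. degree q \<le> 2 * card J - 2 \<Longrightarrow>
      (\<Sum>i\<in>I. W i * poly q (x i)) = (\<Sum>j\<in>J. C j * poly q (y j))"
    and "k \<in> J"
  shows "(\<Sum>j | j \<in> J \<and> y j < y k. C j) \<le> (\<Sum>i | i \<in> I \<and> x i < y k. W i)"
proof -
  have "(\<Sum>i | i \<in> I \<and> - x i \<le> - y k. W i) \<le> (\<Sum>j | j \<in> J \<and> - y j \<le> - y k. C j)"
  proof (rule stieltjes_le)
    fix q :: "real poly" assume "degree q \<le> 2 * card J - 2"
    then have "degree (pcompose q [:0, -1:]) \<le> 2 * card J - 2"
      by (simp add: degree_pcompose)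
    from quad[OF this] show "(\<Sum>i\<in>I. W i * poly q (- x i)) = (\<Sum>j\<in>J. C j * poly q (- y j))"
      by (simp add: poly_pcompose)
  qed (use assms in \<open>auto simp: inj_on_def\<close>)
  moreover have "(\<Sum>i\<in>I. W i) = (\<Sum>j\<in>J. C j)" using quad[of 1] by simp
  moreover have "(\<Sum>i\<in>I. W i) = (\<Sum>i | i \<in> I \<and> x i < y k. W i) + (\<Sum>i | i \<in> I \<and> y k \<le> x i. W i)"
    using assms(1) by (subst sum.union_disjoint[symmetric]) (auto intro!: sum.cong)
  moreover have "(\<Sum>j\<in>J. C j) = (\<Sum>j | j \<in> J \<and> y j < y k. C j) + (\<Sum>j | j \<in> J \<and> y k \<le> y j. C j)"
    using assms(2) by (subst sum.union_disjoint[symmetric]) (auto intro!: sum.cong)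
  ultimately show ?thesis by simp
qed

section \<open>The substitution \<open>1 / (x - s)\<close> and its effect on half-lines\<close>

text \<open>Multiplying \<open>q (1 / (x - s))\<close> by \<open>(x - s) ^ d\<close> turns its
  \<open>i\<close>-th term into a multiple of \<open>(x - s) ^ (d - i)\<close>, which gives the
  numerator \<open>p\<close>.\<close>

lemma rational_with_pole_reciprocal:
  assumes "degree q \<le> d"
  obtains p where "degree p \<le> d"
    "\<And>x. x \<noteq> s \<Longrightarrow> rational_with_pole p s d x = of_real (poly q (1 / (x - s)))"
proof
  define p :: "complex poly" where
    "p = (\<Sum>i\<le>d. smult (of_real (coeff q i)) ([:- of_real s, 1:] ^ (d - i)))"
  show "degree p \<le> d"
    unfolding p_def
    by (intro degree_sum_le) (auto simp: degree_power_eq intro!: order_trans[OF degree_smult_le])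
  fix x :: real assume x: "x \<noteq> s"
  have "rational_with_pole p s d x
      = (\<Sum>i\<le>d. of_real (coeff q i) * (of_real (x - s) ^ (d - i) / of_real (x - s) ^ d))"
    by (simp add: rational_with_pole_def p_def poly_sum poly_power sum_divide_distrib)
  also have "\<dots> = (\<Sum>i\<le>d. of_real (coeff q i * (1 / (x - s)) ^ i))"
    using x by (intro sum.cong) (auto simp: power_diff power_divide simp del: of_real_diff)
  also have "\<dots> = of_real (poly q (1 / (x - s)))"
    using assms by (subst poly_altdef)
      (auto simp: le_degree simp del: of_real_mult intro!: arg_cong[of _ _ of_real] sum.mono_neutral_right)
  finally show "rational_with_pole p s d x = of_real (poly q (1 / (x - s)))" .
qed

lemma spectral_mass_Un_disjoint:
  assumes "A \<inter> B = {}"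
  shows "spectral_mass n lam w (A \<union> B) = spectral_mass n lam w A + spectral_mass n lam w B"
  unfolding spectral_mass_def
  using assms by (subst sum.union_disjoint[symmetric]) (auto intro!: sum.cong)

lemma spectral_mass_cong:
  assumes "\<And>j. j \<in> {1..n} \<Longrightarrow> lam j \<in> A \<longleftrightarrow> lam j \<in> B"
  shows "spectral_mass n lam w A = spectral_mass n lam w B"
  unfolding spectral_mass_def using assms by (intro sum.cong) auto

text \<open>The map \<open>x \<mapsto> 1 / (x - s)\<close> decreases on each side of
  \<open>s\<close> and is negative exactly on the left side. A half-line ending at the image of
  \<open>t\<close> therefore pulls back to one interval if \<open>t < s\<close>, and otherwise to
  two rays.\<close>

lemma reciprocal_le_iff:
  fixes x t s :: real
  assumes "x \<noteq> s" "t \<noteq> s"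
  shows "1 / (x - s) \<le> 1 / (t - s) \<longleftrightarrow> x \<in> (if t < s then {t..<s} else {..<s} \<union> {t..})"
  using assms by (auto simp: divide_simps)

lemma reciprocal_less_iff:
  fixes x t s :: real
  assumes "x \<noteq> s" "t \<noteq> s"
  shows "1 / (x - s) < 1 / (t - s) \<longleftrightarrow> x \<in> (if t < s then {t<..<s} else {..<s} \<union> {t<..})"
  using assms by (auto simp: divide_simps)

section \<open>Half-line comparisons and the three claims\<close>

theorem corollary4p16:
  fixes m n :: nat and a b :: ereal and s :: real
    and lam theta :: "nat \<Rightarrow> real" and w c :: "nat \<Rightarrow> complex"
  assumes "1 \<le> m" and "m < n"
    and "strict_mono_on {1..n} lam"
    and "\<forall>j\<in>{1..n}. lam j \<in> einterval a b"
    and "\<forall>j\<in>{1..n}. w j \<noteq> 0"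
    and "\<forall>j\<in>{1..n}. s \<noteq> lam j"
    and "strict_mono_on {1..m} theta"
    and "\<forall>j\<in>{1..m}. theta j \<in> einterval a b"
    and "\<forall>j\<in>{1..m}. theta j \<noteq> s"
    and "\<forall>p :: complex poly. degree p \<le> 2 * m - 2 \<longrightarrow>
           (\<Sum>j=1..n. of_real ((cmod (w j))\<^sup>2) * rational_with_pole p s (2 * m - 2) (lam j))
         = (\<Sum>j=1..m. of_real ((cmod (c j))\<^sup>2) * rational_with_pole p s (2 * m - 2) (theta j))"
    and "s \<in> {theta 1<..<theta m}"
  shows
    "(\<forall>k\<in>{1..m-1}.
        spectral_mass n lam w {theta 1..theta k} \<le> (\<Sum>i=1..k. (cmod (c i))\<^sup>2) \<and>
        (\<Sum>i=1..k. (cmod (c i))\<^sup>2)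
          \<le> spectral_mass n lam w
               (einterval a (ereal (theta (k + 1))) \<union> einterval (ereal (theta m)) b)) \<and>
     (\<forall>j k. 1 < j \<and> j < k \<and> k < m \<longrightarrow>
        spectral_mass n lam w {theta j..theta k} \<le> (\<Sum>i=j..k. (cmod (c i))\<^sup>2) \<and>
        (\<Sum>i=j..k. (cmod (c i))\<^sup>2)
          \<le> spectral_mass n lam w {theta (j - 1)<..<theta (k + 1)}) \<and>
     (\<forall>j\<in>{2..m}.
        spectral_mass n lam w {theta j..theta m} \<le> (\<Sum>i=j..m. (cmod (c i))\<^sup>2) \<and>
        (\<Sum>i=j..m. (cmod (c i))\<^sup>2)
          \<le> spectral_mass n lam w
               (einterval a (ereal (theta 1)) \<union> einterval (ereal (theta (j - 1))) b))"
proof -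
  define M where "M = spectral_mass n lam w"
  \<comment> \<open>The quadrature nodes are treated as a second mass distribution, so
    \<open>K X - M X\<close> is the \<open>e(X)\<close> of the overview.\<close>
  define K where "K = spectral_mass m theta c"
  have quad: "(\<Sum>j=1..n. (cmod (w j))\<^sup>2 * poly q (1 / (lam j - s)))
      = (\<Sum>j=1..m. (cmod (c j))\<^sup>2 * poly q (1 / (theta j - s)))"
    if deg: "degree q \<le> 2 * card {1..m} - 2" for q
  proof -
    obtain p where p: "degree p \<le> 2 * m - 2"
      "\<And>x. x \<noteq> s \<Longrightarrow> rational_with_pole p s (2 * m - 2) x = of_real (poly q (1 / (x - s)))"
      using rational_with_pole_reciprocal[of q "2 * m - 2" s] deg by auto
    have "complex_of_real (\<Sum>j=1..n. (cmod (w j))\<^sup>2 * poly q (1 / (lam j - s)))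
        = (\<Sum>j=1..n. of_real ((cmod (w j))\<^sup>2) * rational_with_pole p s (2 * m - 2) (lam j))"
      unfolding of_real_sum of_real_mult
      by (intro sum.cong refl arg_cong2[of _ _ _ _ "(*)"] p(2)[symmetric]) (use assms(6) in auto)
    also have "\<dots> = (\<Sum>j=1..m. of_real ((cmod (c j))\<^sup>2) * rational_with_pole p s (2 * m - 2) (theta j))"
      using assms(10) p(1) by blast
    also have "\<dots> = complex_of_real (\<Sum>j=1..m. (cmod (c j))\<^sup>2 * poly q (1 / (theta j - s)))"
      unfolding of_real_sum of_real_mult
      by (intro sum.cong refl arg_cong2[of _ _ _ _ "(*)"] p(2)) (use assms(9) in auto)
    finally show ?thesis by (simp only: of_real_eq_iff)
  qed
  have inj: "inj_on (\<lambda>j. 1 / (theta j - s)) {1..m}"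
  proof (rule inj_onI)
    fix i j assume "i \<in> {1..m}" "j \<in> {1..m}" "1 / (theta i - s) = 1 / (theta j - s)"
    moreover from this(3) have "theta i = theta j" by simp
    ultimately show "i = j" using strict_mono_on_imp_inj_on[OF assms(7)] by (simp only: inj_on_eq_iff)
  qed
  have total: "M UNIV = K UNIV"
    using quad[of 1] by (simp add: M_def K_def spectral_mass_def del: atLeastAtMost_iff)
  have add: "M C = M A + M B" "K C = K A + K B" if "A \<inter> B = {}" "A \<union> B = C" for A B C
    using that by (auto simp: M_def K_def spectral_mass_Un_disjoint)
  have key: "K {..<theta k} - M {..<theta k} \<le> K {..<s} - M {..<s}
      \<and> K {..<s} - M {..<s} \<le> K {..theta k} - M {..theta k}" if k: "k \<in> {1..m}" for k
  proof -
    \<comment> \<open>\<open>A\<close> and \<open>B\<close> are the preimages of the closed and the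
      open half-line ending at \<open>1 / (theta k - s)\<close>, so \<open>e(A) \<ge> 0\<close> and
      \<open>e(B) \<le> 0\<close>.\<close>
    define A where "A = (if theta k < s then {theta k..<s} else {..<s} \<union> {theta k..})"
    define B where "B = (if theta k < s then {theta k<..<s} else {..<s} \<union> {theta k<..})"
    have "{j. j \<in> {1..n} \<and> 1 / (lam j - s) \<le> 1 / (theta k - s)} = {j. j \<in> {1..n} \<and> lam j \<in> A}"
      "{j. j \<in> {1..m} \<and> 1 / (theta j - s) \<le> 1 / (theta k - s)} = {j. j \<in> {1..m} \<and> theta j \<in> A}"
      unfolding A_def
      by (intro Collect_cong conj_cong refl reciprocal_le_iff; use assms(6,9) k in auto)+
    then have "M A \<le> K A"
      using stieltjes_le[OF _ _ inj _ quad k] by (simp add: M_def K_def spectral_mass_def)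
    have "{j. j \<in> {1..n} \<and> 1 / (lam j - s) < 1 / (theta k - s)} = {j. j \<in> {1..n} \<and> lam j \<in> B}"
      "{j. j \<in> {1..m} \<and> 1 / (theta j - s) < 1 / (theta k - s)} = {j. j \<in> {1..m} \<and> theta j \<in> B}"
      unfolding B_def
      by (intro Collect_cong conj_cong refl reciprocal_less_iff; use assms(6,9) k in auto)+
    then have "K B \<le> M B"
      using stieltjes_less[OF _ _ inj _ quad k] by (simp add: M_def K_def spectral_mass_def)
    show ?thesis
    proof (cases "theta k < s")
      \<comment> \<open>Here \<open>A\<close> and \<open>B\<close> are what remains of
        \<open>{..<s}\<close> after removing \<open>{..<theta k}\<close> and
        \<open>{..theta k}\<close>.\<close>
      case True
      then have "{..<theta k} \<inter> A = {}" "{..<theta k} \<union> A = {..<s}"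
        "{..theta k} \<inter> B = {}" "{..theta k} \<union> B = {..<s}"
        by (auto simp: A_def B_def)
      from add[OF this(1,2)] add[OF this(3,4)] show ?thesis
        using \<open>M A \<le> K A\<close> \<open>K B \<le> M B\<close> by linarith
    next
      \<comment> \<open>Here \<open>e(A) = e({..<s}) + e({theta k..})\<close>, and total 0 turns the
        last term into \<open>- e({..<theta k})\<close>; \<open>B\<close> is treated alike.\<close>
      case False
      then have "{..<s} \<inter> {theta k..} = {}" "{..<s} \<union> {theta k..} = A"
        "{..<s} \<inter> {theta k<..} = {}" "{..<s} \<union> {theta k<..} = B"
        by (auto simp: A_def B_def)
      note AB = add[OF this(1,2)] add[OF this(3,4)]
      have "{..<theta k} \<inter> {theta k..} = {}" "{..<theta k} \<union> {theta k..} = UNIV"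
        "{..theta k} \<inter> {theta k<..} = {}" "{..theta k} \<union> {theta k<..} = UNIV"
        by auto
      from add[OF this(1,2)] add[OF this(3,4)] AB show ?thesis
        using total \<open>M A \<le> K A\<close> \<open>K B \<le> M B\<close> by linarith
    qed
  qed
  have le: "theta i \<le> theta j \<longleftrightarrow> i \<le> j" if "i \<in> {1..m}" "j \<in> {1..m}" for i j
    using strict_mono_on_less_eq[OF assms(7) that] .
  have lt: "theta i < theta j \<longleftrightarrow> i < j" if "i \<in> {1..m}" "j \<in> {1..m}" for i j
    using strict_mono_on_less[OF assms(7) that] .
  \<comment> \<open>The bound \<open>2 \<le> j\<close> keeps \<open>j - 1\<close> a valid index
    under truncated subtraction.\<close>
  have prev_lt: "theta (j - 1) < theta i \<longleftrightarrow> j \<le> i" if "j \<in> {2..m}" "i \<in> {1..m}" for i j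
    using lt[of "j - 1" i] that by (cases j) auto
  have K_eq: "(\<Sum>i=j..k. (cmod (c i))\<^sup>2) = K R"
    if "1 \<le> j" "j \<le> k" "k \<le> m" "\<And>i. i \<in> {1..m} \<Longrightarrow> theta i \<in> R \<longleftrightarrow> j \<le> i \<and> i \<le> k" for j k R
  proof -
    have "{i. i \<in> {1..m} \<and> theta i \<in> R} = {j..k}" using that by auto
    then show ?thesis by (simp add: K_def spectral_mass_def)
  qed
  \<comment> \<open>\<open>e({theta j..theta k})\<close> is
    \<open>e({..theta k}) - e({..<theta j})\<close>, and \<open>key\<close> places
    \<open>e({..<s})\<close> between the two terms.\<close>
  have lower: "M {theta j..theta k} \<le> (\<Sum>i=j..k. (cmod (c i))\<^sup>2)"
    if "1 \<le> j" "j \<le> k" "k \<le> m" for j k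
  proof -
    have "{..<theta j} \<inter> {theta j..theta k} = {}"
      "{..<theta j} \<union> {theta j..theta k} = {..theta k}"
      using le[of j k] that by auto
    note add[OF this]
    moreover have "K {theta j..theta k} = (\<Sum>i=j..k. (cmod (c i))\<^sup>2)"
      by (rule K_eq[symmetric]) (use that le in auto)
    ultimately show ?thesis using key[of j] key[of k] that by simp
  qed
  have inner: "K {theta i<..<theta l} \<le> M {theta i<..<theta l}"
    if "i \<in> {1..m}" "l \<in> {1..m}" "i < l" for i l
  proof -
    have "{..theta i} \<inter> {theta i<..<theta l} = {}"
      "{..theta i} \<union> {theta i<..<theta l} = {..<theta l}"
      using lt[OF that(1,2)] that(3) by auto
    from add[OF this] show ?thesis using key[OF that(1)] key[OF that(2)] by simp
  qed
  \<comment> \<open>As the total is 0, \<open>e\<close> of this union is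
    \<open>e({..<theta i}) - e({..theta l})\<close>, which \<open>key\<close> bounds by 0.\<close>
  have outer: "K ({..<theta i} \<union> {theta l<..}) \<le> M ({..<theta i} \<union> {theta l<..})"
    if "i \<in> {1..m}" "l \<in> {1..m}" "i \<le> l" for i l
  proof -
    have "{..theta l} \<inter> {theta l<..} = {}" "{..theta l} \<union> {theta l<..} = UNIV" by auto
    note add[OF this]
    moreover have "{..<theta i} \<inter> {theta l<..} = {}" using le[OF that(1,2)] that(3) by auto
    note add[OF this refl]
    ultimately show ?thesis using key[OF that(1)] key[OF that(2)] total by linarith
  qed
  \<comment> \<open>All \<open>lam j\<close> lie in \<open>(a, b)\<close>, so cutting the rays off
    at \<open>a\<close> and \<open>b\<close> loses no mass.\<close>
  have outer_eq: "M (einterval a (ereal t) \<union> einterval (ereal u) b) = M ({..<t} \<union> {u<..})" for t u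
    unfolding M_def using assms(4) by (intro spectral_mass_cong) (auto simp: einterval_def)
  have a: "M {theta 1..theta k} \<le> (\<Sum>i=1..k. (cmod (c i))\<^sup>2)"
      "(\<Sum>i=1..k. (cmod (c i))\<^sup>2) \<le> M ({..<theta (k + 1)} \<union> {theta m<..})" if "k \<in> {1..m-1}" for k
  proof -
    show "M {theta 1..theta k} \<le> (\<Sum>i=1..k. (cmod (c i))\<^sup>2)" using that by (intro lower) auto
    \<comment> \<open>No node exceeds \<open>theta m\<close>, so the right-hand ray adds nothing to
      \<open>K\<close>; it matters only for \<open>M\<close>.\<close>
    have "(\<Sum>i=1..k. (cmod (c i))\<^sup>2) = K ({..<theta (k + 1)} \<union> {theta m<..})"
      by (rule K_eq) (use that in \<open>auto simp: lt\<close>)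
    then show "(\<Sum>i=1..k. (cmod (c i))\<^sup>2) \<le> M ({..<theta (k + 1)} \<union> {theta m<..})"
      using outer[of "k + 1" m] that by auto
  qed
  have b: "M {theta j..theta k} \<le> (\<Sum>i=j..k. (cmod (c i))\<^sup>2)"
      "(\<Sum>i=j..k. (cmod (c i))\<^sup>2) \<le> M {theta (j - 1)<..<theta (k + 1)}" if "1 < j" "j < k" "k < m" for j k
  proof -
    show "M {theta j..theta k} \<le> (\<Sum>i=j..k. (cmod (c i))\<^sup>2)" using that by (intro lower) auto
    have "(\<Sum>i=j..k. (cmod (c i))\<^sup>2) = K {theta (j - 1)<..<theta (k + 1)}"
      by (rule K_eq) (use that prev_lt[of j] in \<open>auto simp: lt\<close>)
    moreover have "j - 1 \<in> {1..m}" "k + 1 \<in> {1..m}" "j - 1 < k + 1" using that by auto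
    note inner[OF this]
    ultimately show "(\<Sum>i=j..k. (cmod (c i))\<^sup>2) \<le> M {theta (j - 1)<..<theta (k + 1)}"
      by (simp only:)
  qed
  have c: "M {theta j..theta m} \<le> (\<Sum>i=j..m. (cmod (c i))\<^sup>2)"
      "(\<Sum>i=j..m. (cmod (c i))\<^sup>2) \<le> M ({..<theta 1} \<union> {theta (j - 1)<..})" if "j \<in> {2..m}" for j
  proof -
    show "M {theta j..theta m} \<le> (\<Sum>i=j..m. (cmod (c i))\<^sup>2)" using that by (intro lower) auto
    have "(\<Sum>i=j..m. (cmod (c i))\<^sup>2) = K ({..<theta 1} \<union> {theta (j - 1)<..})"
      by (rule K_eq) (use that prev_lt[of j] in \<open>auto simp: lt\<close>)
    moreover have "1 \<in> {1..m}" "j - 1 \<in> {1..m}" "1 \<le> j - 1" using that by auto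
    note outer[OF this]
    ultimately show "(\<Sum>i=j..m. (cmod (c i))\<^sup>2) \<le> M ({..<theta 1} \<union> {theta (j - 1)<..})"
      by (simp only:)
  qed
  show ?thesis
    unfolding M_def[symmetric] outer_eq using a b c by blast
qed

end
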